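(* Let $w$ be a finite word of length $n$. Then the number $\mathrm{Sq}([w])$ of distinct square factors of the circular word $[w]$ satisfies $\mathrm{Sq}([w])\le \frac{5}{3}n$.
   Context: A word is a finite sequence of letters (over any alphabet). A word $u$ is a factor of $w$ if $w=pus$ for some (possibly empty) words $p,s$. Two finite words $u,v$ are conjugate if $u=xy$ and $v=yx$ for some (possibly empty) words $x,y$. The circular word $[w]$ is the conjugacy class of $w$, i.e. the set of all cyclic rotations of $w$. A square is a word of the form $uu$ with $u$ a nonempty finite word. $\mathrm{Sq}([w])$ denotes the number of distinct (nonempty) squares that are factors of at least one element of $[w]$. *)

theory Defs
  imports Complex_Main "HOL-Library.Sublist"
begin

text \<open>Words are lists over an arbitrary alphabet type; \<open>sublist u w\<close> from the library says that
  \<open>u\<close> is a (contiguous) factor of \<open>w\<close>.\<close>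

definition conjugate :: "'a list \<Rightarrow> 'a list \<Rightarrow> bool" where
  "conjugate u v \<longleftrightarrow> (\<exists>x y. u = x @ y \<and> v = y @ x)"

definition circular_word :: "'a list \<Rightarrow> 'a list set" where
  "circular_word w = {v. conjugate w v}"

definition is_square :: "'a list \<Rightarrow> bool" where
  "is_square s \<longleftrightarrow> (\<exists>u. u \<noteq> [] \<and> s = u @ u)"

definition square_factors :: "'a list set \<Rightarrow> 'a list set" where
  "square_factors C = {s. is_square s \<and> (\<exists>v\<in>C. sublist s v)}"

definition Sq :: "'a list set \<Rightarrow> nat" where
  "Sq C = card (square_factors C)"

text \<open>The set counted by \<open>Sq (circular_word w)\<close> is finite, so \<open>card\<close> is the true number of squares.\<close>

lemma finite_square_factors_circular_word: "finite (square_factors (circular_word w))"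
proof (rule finite_subset)
  show "square_factors (circular_word w) \<subseteq> {s. set s \<subseteq> set w \<and> length s \<le> length w}"
  proof
    fix s assume "s \<in> square_factors (circular_word w)"
    then obtain x y p q where "w = x @ y" "y @ x = p @ s @ q"
      unfolding square_factors_def circular_word_def conjugate_def sublist_def by blast
    moreover from this have "set w = set (p @ s @ q)" "length w = length (p @ s @ q)"
      by (metis Un_commute set_append, metis add.commute length_append)
    ultimately show "s \<in> {s. set s \<subseteq> set w \<and> length s \<le> length w}"
      by auto
  qed
next
  show "finite {s. set s \<subseteq> set w \<and> length s \<le> length w}"
    by (rule finite_lists_length_le) simp
qed

end

theory Submission
  imports Defs
begin

text \<open>
Let \<open>W\<close> be the periodic sequence obtained by repeating \<open>w\<close>, let \<open>C L\<close> be its number of factors of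
length \<open>L\<close>, and let the Rauzy graph of order \<open>k\<close> have the factors of length \<open>k\<close> as vertices and those of
length \<open>Suc k\<close> as edges, from their prefix to their suffix. A periodic sequence \<open>p\<close>, taken up to shift and
of least period \<open>l\<close>, is a closed walk in that graph if all its factors of length \<open>Suc k\<close> occur in \<open>W\<close>;
call it a circuit that is full at length \<open>Suc k\<close>.

Squares are charged to circuits. A square is a factor of length \<open>2 * m * l\<close> of a circuit \<open>p\<close>. If \<open>t\<close> of
the \<open>l\<close> such factors occur in \<open>W\<close>, then \<open>p\<close> is full at the \<open>t\<close> lengths from \<open>m * l + 1\<close> to \<open>m * l + t\<close>
(\<open>full_range\<close>), and these determine \<open>m\<close>. Hence the number of squares is at most the sum over
\<open>2 \<le> L \<le> n\<close> of the number \<open>N L\<close> of circuits with \<open>m * l < L \<le> (m + 1) * l\<close> and \<open>2 * m * l \<le> n\<close> for some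
\<open>m \<ge> 1\<close> that are full at \<open>L\<close> (\<open>card_squares_le\<close>).

Distinct full circuits are independent: each has an unbordered factor, and an edge containing it lies in no
other circuit that is not longer (\<open>private_factor\<close>). Deleting these edges, longest circuit first, keeps the
graph connected, so \<open>N L \<le> C L - C (L - 1) + 1\<close> (\<open>rauzy_card\<close>). Summation gives about \<open>2 * n\<close>, and the
term \<open>1\<close> has to be saved for the lengths \<open>L > 2 * n / 3\<close>.

So let \<open>w\<close> be primitive, \<open>L > 2 * n / 3\<close>, and suppose equality. Then the edges that survive form a spanning
tree, on which no flow is supported, so the closed walk \<open>W\<close> is an integer combination of the circuits
(\<open>circuits_span\<close>), and \<open>n\<close> is the same combination of their lengths. Two circuits with a common vertex
have \<open>l + l' \<ge> L + 1\<close>, since the number of their factors increases with the length (\<open>card_union_lower\<close>).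
The choice of \<open>m\<close> puts each \<open>l\<close> between \<open>L / 2\<close> and \<open>n / 2\<close> or between \<open>L / 3\<close> and \<open>n / 4\<close>.
There are at most three circuits, as otherwise \<open>C L\<close> would exceed \<open>n\<close>; no coefficient is negative; and
the remaining sums force circuits with a common vertex to have lengths \<open>n / 2\<close> and \<open>n / 2\<close>, or \<open>n / 2\<close>
and \<open>n / 4\<close>. Then they have a common period shorter than \<open>L\<close> and are the same circuit, a contradiction
(\<open>tight_circuits.contradiction\<close>). Therefore the sum is at most \<open>C n + 2 * n / 3\<close>. If \<open>w\<close> is not primitive,
then \<open>C n \<le> n / 2\<close> and the weaker bound suffices.
\<close>

section \<open>Factors of periodic sequences\<close>

definition fac :: "(nat \<Rightarrow> 'a) \<Rightarrow> nat \<Rightarrow> nat \<Rightarrow> 'a list" where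
  "fac x i L = map x [i..<i + L]"

definition facs :: "(nat \<Rightarrow> 'a) \<Rightarrow> nat \<Rightarrow> 'a list set" where
  "facs x L = range (\<lambda>i. fac x i L)"

definition periodic :: "(nat \<Rightarrow> 'a) \<Rightarrow> nat \<Rightarrow> bool" where
  "periodic x d \<longleftrightarrow> d > 0 \<and> (\<forall>i. x (i + d) = x i)"

definition cyclic :: "(nat \<Rightarrow> 'a) \<Rightarrow> bool" where
  "cyclic x \<longleftrightarrow> (\<exists>d. periodic x d)"

definition per :: "(nat \<Rightarrow> 'a) \<Rightarrow> nat" where
  "per x = (LEAST d. periodic x d)"

text \<open>Two tails are compared, so that the relation is symmetric by definition; for periodic sequences
it says that one is a shift of the other.\<close>

definition shift_eq :: "(nat \<Rightarrow> 'a) \<Rightarrow> (nat \<Rightarrow> 'a) \<Rightarrow> bool" where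
  "shift_eq x y \<longleftrightarrow> (\<exists>a b. \<forall>t. x (a + t) = y (b + t))"

lemma length_fac [simp]: "length (fac x i L) = L"
  by (simp add: fac_def)

lemma fac_eq_iff: "fac x i L = fac y j L \<longleftrightarrow> (\<forall>t<L. x (i + t) = y (j + t))"
  by (auto simp: fac_def list_eq_iff_nth_eq)

lemma fac_add: "fac x i (L + M) = fac x i L @ fac x (i + L) M"
  by (simp add: fac_def add.assoc[symmetric] upt_add_eq_append[symmetric] flip: map_append)

lemma take_fac: "K \<le> L \<Longrightarrow> take K (fac x i L) = fac x i K"
  by (auto simp: fac_def take_map)

lemma tl_fac: "tl (fac x i (Suc k)) = fac x (Suc i) k"
  by (simp add: fac_def map_tl flip: tl_upt)

lemma butlast_fac: "butlast (fac x i (Suc k)) = fac x i k"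
  by (simp add: fac_def)

lemma fac_in_facs [simp]: "fac x i L \<in> facs x L"
  by (auto simp: facs_def)

lemma facs_mono:
  assumes "facs x L \<subseteq> facs y L" "K \<le> L"
  shows "facs x K \<subseteq> facs y K"
proof
  fix u assume "u \<in> facs x K"
  then obtain i where u: "u = fac x i K" by (auto simp: facs_def)
  have "fac x i L \<in> facs y L" using assms by auto
  then obtain j where "fac x i L = fac y j L" by (auto simp: facs_def)
  then have "u = fac y j K" using take_fac[OF assms(2)] u by metis
  then show "u \<in> facs y K" by simp
qed

lemma periodic_mult: "periodic x d \<Longrightarrow> x (i + m * d) = x i"
proof (induction m)
  case (Suc m)
  have "x (i + Suc m * d) = x (i + m * d + d)" by (simp add: add.commute add.left_commute)
  then show ?case using Suc by (simp add: periodic_def)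
qed simp

lemma periodic_mod: "periodic x d \<Longrightarrow> x (i mod d) = x i"
  by (metis mod_div_mult_eq periodic_mult)

lemma periodic_mod_add:
  assumes "periodic x d" shows "x (i mod d + t) = x (i + t)"
  using periodic_mod[OF assms, of "i mod d + t"] periodic_mod[OF assms, of "i + t"]
  by (simp add: mod_add_left_eq)

lemma periodic_mult_period: "periodic x d \<Longrightarrow> m > 0 \<Longrightarrow> periodic x (m * d)"
  using periodic_mult[of x d] by (simp add: periodic_def)

lemma fac_mod: "periodic x d \<Longrightarrow> fac x (i mod d) L = fac x i L"
  by (simp add: fac_eq_iff periodic_mod_add)

lemma facs_image: "periodic x d \<Longrightarrow> facs x L = (\<lambda>i. fac x i L) ` {..<d}"
  unfolding facs_def by (auto simp: image_iff) (metis fac_mod lessThan_iff mod_less_divisor periodic_def)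

lemma finite_facs: "cyclic x \<Longrightarrow> finite (facs x L)"
  unfolding cyclic_def using facs_image by fastforce

lemma card_facs_le: "periodic x d \<Longrightarrow> card (facs x L) \<le> d"
  using facs_image card_image_le by (metis card_lessThan finite_lessThan)

lemma periodic_per: "cyclic x \<Longrightarrow> periodic x (per x)"
  unfolding cyclic_def per_def by (rule LeastI_ex)

lemma per_le: "periodic x d \<Longrightarrow> per x \<le> d"
  unfolding per_def by (rule Least_le)

lemma per_pos: "cyclic x \<Longrightarrow> per x > 0"
  using periodic_per periodic_def by blast

lemma per_dvd:
  assumes "periodic x d" shows "per x dvd d"
proof (rule ccontr)
  assume "\<not> per x dvd d"
  have p: "periodic x (per x)" using assms cyclic_def periodic_per by blast
  let ?r = "d mod per x"
  have "?r > 0" using \<open>\<not> per x dvd d\<close> by (simp add: mod_greater_zero_iff_not_dvd)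
  moreover have "x (i + ?r) = x i" for i
  proof -
    have "x (i + ?r) = x (i + ?r + (d div per x) * per x)" using periodic_mult[OF p] by metis
    also have "\<dots> = x (i + d)" by (simp add: add.assoc)
    also have "\<dots> = x i" using assms periodic_def by blast
    finally show ?thesis .
  qed
  ultimately have "per x \<le> ?r" using per_le periodic_def by blast
  moreover have "per x > 0" using p periodic_def by blast
  ultimately show False using mod_less_divisor[of "per x" d] by linarith
qed

lemma agree_all:
  assumes "periodic x d" "periodic y d" "d \<le> L" "fac x a L = fac y b L"
  shows "x (a + t) = y (b + t)"
proof -
  have "d > 0" using assms periodic_def by blast
  then have "t mod d < L" using assms(3) by (meson mod_less_divisor less_le_trans)
  then have "x (a + t mod d) = y (b + t mod d)" using assms(4) by (simp add: fac_eq_iff)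
  then show ?thesis using periodic_mod_add[OF assms(1), of t a] periodic_mod_add[OF assms(2), of t b]
    by (simp add: add.commute)
qed

text \<open>Equality of two tails reaches the terms before them by going forward by a multiple of the period.\<close>

lemma shift_self_period:
  assumes "cyclic x" "a < b" "\<And>t. x (a + t) = x (b + t)"
  shows "periodic x (b - a)"
proof -
  have p: "periodic x (per x)" using assms periodic_per by blast
  have "x (i + (b - a)) = x i" for i
  proof -
    have "a * per x \<ge> a" using p by (simp add: periodic_def Suc_leI)
    then have e: "i + a * per x = a + (i + a * per x - a)" by linarith
    have "x i = x (i + a * per x)" using periodic_mult[OF p] by metis
    also have "\<dots> = x (b + (i + a * per x - a))" using assms(3) e by metis
    also have "b + (i + a * per x - a) = i + (b - a) + a * per x" using assms(2) \<open>a * per x \<ge> a\<close> by linarith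
    also have "x \<dots> = x (i + (b - a))" using periodic_mult[OF p] by metis
    finally show ?thesis by simp
  qed
  then show ?thesis using assms by (simp add: periodic_def)
qed

lemma fac_inj:
  assumes "cyclic x" "per x \<le> L"
  shows "inj_on (\<lambda>i. fac x i L) {..<per x}"
proof -
  have *: "False" if "i < j" "j < per x" "fac x i L = fac x j L" for i j
  proof -
    have "x (i + t) = x (j + t)" for t
      using agree_all[OF periodic_per periodic_per] assms that by blast
    then have "periodic x (j - i)" using shift_self_period assms(1) that(1) by blast
    then have "per x \<le> j - i" by (rule per_le)
    then show False using that by simp
  qed
  show ?thesis
    by (rule inj_onI) (metis * lessThan_iff linorder_neqE_nat)
qed

lemma card_facs_eq: "cyclic x \<Longrightarrow> per x \<le> L \<Longrightarrow> card (facs x L) = per x"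
  by (simp add: facs_image[OF periodic_per] card_image fac_inj)

lemma shift_eq_common_period:
  assumes "periodic x d" "periodic y d" "d \<le> L" "facs x L \<inter> facs y L \<noteq> {}"
  shows "shift_eq x y"
proof -
  obtain a b where "fac x a L = fac y b L" using assms(4) by (auto simp: facs_def)
  then show ?thesis unfolding shift_eq_def using agree_all assms(1-3) by blast
qed

text \<open>The factor of length \<open>per x\<close> that is least in a lexicographic order (a Lyndon word) has no border:
if \<open>u = b @ c = d @ b\<close>, then \<open>b @ d\<close> and \<open>c @ b\<close> are rotations of \<open>u\<close>, and minimality gives \<open>c = d\<close>, so \<open>u\<close>
equals one of its proper rotations.\<close>

lemma exists_unbordered:
  assumes x: "cyclic x"
  shows "\<exists>j. \<forall>q. 0 < q \<and> q < per x \<longrightarrow> fac x j (per x - q) \<noteq> fac x (j + q) (per x - q)"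
proof -
  let ?l = "per x"
  have p: "periodic x ?l" using x periodic_per by blast
  obtain r :: "'a rel" where r: "well_order_on UNIV r"
    using well_order_on by (rule exE)
  define R where "R = r - Id"
  have "wf R" using r unfolding R_def by (simp only: well_order_on_def)
  have "total R" using r unfolding R_def by (simp add: well_order_on_def linear_order_on_def)
  have "irrefl R" unfolding R_def irrefl_def by simp
  have wfl: "wf (lenlex R)" using \<open>wf R\<close> by (rule wf_lenlex)
  have tot: "total (lenlex R)" using \<open>total R\<close> by (rule total_lenlex)
  obtain u where u: "u \<in> facs x ?l" and min: "\<And>v. (v, u) \<in> lenlex R \<Longrightarrow> v \<notin> facs x ?l"
    using wfE_min[OF wfl, of "fac x 0 ?l" "facs x ?l"] by auto
  obtain j where j: "u = fac x j ?l" using u by (auto simp: facs_def)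
  have "fac x j (?l - q) \<noteq> fac x (j + q) (?l - q)" if q: "0 < q" "q < ?l" for q
  proof
    assume eq: "fac x j (?l - q) = fac x (j + q) (?l - q)"
    define b where "b = fac x j (?l - q)"
    define c where "c = fac x (j + (?l - q)) q"
    define d where "d = fac x j q"
    have shift: "fac x (i + ?l) K = fac x i K" for i K
      using fac_mod[OF p, of "i + ?l" K] fac_mod[OF p, of i K] by simp
    have ubc: "u = b @ c"
      using fac_add[of x j "?l - q" q] q by (simp add: j b_def c_def)
    have udb: "u = d @ b"
      using fac_add[of x j q "?l - q"] q eq by (simp add: j b_def d_def)
    have bd: "fac x (j + q) ?l = b @ d"
      using fac_add[of x "j + q" "?l - q" q] q eq shift[of j q] by (simp add: b_def d_def)
    have cb: "fac x (j + (?l - q)) ?l = c @ b"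
      using fac_add[of x "j + (?l - q)" q "?l - q"] q shift[of j "?l - q"] by (simp add: b_def c_def)
    have "(d, c) \<notin> lenlex R"
      using min[of "b @ d"] bd ubc lenlex_append2[OF \<open>irrefl R\<close>, of b d c] fac_in_facs by metis
    moreover have "(c, d) \<notin> lenlex R"
      using min[of "c @ b"] cb udb lenlex_append1[of c d R b b] fac_in_facs by (metis c_def d_def length_fac)
    ultimately have "c = d" using tot by (auto simp: total_on_def)
    then have "fac x j ?l = fac x (j + q) ?l" using ubc bd j by simp
    then have "x (j + t) = x (j + q + t)" for t using agree_all[OF p p] by blast
    then have "periodic x q" using shift_self_period[OF x, of j "j + q"] q by simp
    then show False using per_le q by fastforce
  qed
  then show ?thesis by blast
qed

text \<open>A factor that contains an unbordered word of length \<open>per x\<close> has no period below \<open>per x\<close>.\<close>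

lemma private_factor:
  assumes x: "cyclic x" and L: "per x \<le> L"
  shows "\<exists>e \<in> facs x L. \<forall>y. cyclic y \<and> per y \<le> per x \<and> e \<in> facs y L \<longrightarrow> shift_eq x y"
proof -
  obtain j where j: "\<And>q. 0 < q \<Longrightarrow> q < per x \<Longrightarrow> fac x j (per x - q) \<noteq> fac x (j + q) (per x - q)"
    using exists_unbordered[OF x] by blast
  have "shift_eq x y" if y: "cyclic y" "per y \<le> per x" "fac x j L \<in> facs y L" for y
  proof -
    obtain b where b: "fac x j L = fac y b L" using y(3) by (auto simp: facs_def)
    have b': "x (j + t) = y (b + t)" if "t < L" for t using b that by (simp add: fac_eq_iff)
    have "per y = per x"
    proof (rule ccontr)
      assume "per y \<noteq> per x"
      then have lt: "per y < per x" using y by simp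
      have "x (j + t) = x (j + per y + t)" if "t < per x - per y" for t
      proof -
        have "y (b + t) = y (b + (per y + t))"
          using periodic_per[OF y(1)] unfolding periodic_def by (metis add.assoc add.commute)
        then show ?thesis using b'[of t] b'[of "per y + t"] that L by (simp add: add.assoc)
      qed
      then show False using j[OF per_pos[OF y(1)] lt] by (simp add: fac_eq_iff)
    qed
    then show ?thesis
      using agree_all[OF _ _ L b] periodic_per[OF x] periodic_per[OF y(1)] unfolding shift_eq_def
      by metis
  qed
  then show ?thesis by (intro bexI[of _ "fac x j L"]) simp_all
qed

text \<open>If each factor in \<open>S\<close> is determined by its prefix of length \<open>k\<close>, then any such prefix determines all
that follows it.\<close>

lemma unique_extension:
  assumes inj: "inj_on butlast S" and S: "facs x (Suc k) \<subseteq> S" "facs y (Suc k) \<subseteq> S"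
    and ab: "fac x a k = fac y b k"
  shows "x (a + k + t) = y (b + k + t)"
proof -
  have step: "fac x (Suc a) k = fac y (Suc b) k \<and> x (a + k) = y (b + k)" if "fac x a k = fac y b k" for a b
  proof -
    have "fac x a (Suc k) = fac y b (Suc k)"
      using inj S that fac_in_facs unfolding inj_on_def by (metis butlast_fac subset_iff)
    then show ?thesis by (metis tl_fac fac_eq_iff lessI)
  qed
  have "fac x (a + t) k = fac y (b + t) k"
    by (induction t) (use ab step in auto)
  then show ?thesis using step[of "a + t" "b + t"] by (simp add: add.commute add.left_commute)
qed

lemma butlast_facs: "butlast ` facs x (Suc k) = facs x k"
  by (auto simp: facs_def image_image butlast_fac)

lemma card_facs_mono: "cyclic x \<Longrightarrow> card (facs x k) \<le> card (facs x (Suc k))"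
  by (metis butlast_facs card_image_le finite_facs)

text \<open>The argument of Morse and Hedlund: as soon as the number of factors stops growing, each factor has a
unique extension, so equal factors at different positions within a period would produce a smaller period.\<close>

lemma card_facs_lower:
  assumes x: "cyclic x"
  shows "min (Suc k) (per x) \<le> card (facs x k)"
proof (induction k)
  case 0
  have "facs x 0 = {[]}" by (auto simp: facs_def fac_def)
  then show ?case by simp
next
  case (Suc k)
  show ?case
  proof (cases "card (facs x (Suc k)) = card (facs x k)")
    case True
    then have inj: "inj_on butlast (facs x (Suc k))"
      by (simp add: eq_card_imp_inj_on finite_facs x butlast_facs)
    have *: False if "i < j" "j < per x" "fac x i k = fac x j k" for i j
    proof -
      have "x (i + k + t) = x (j + k + t)" for t
        using unique_extension[OF inj order_refl order_refl that(3)] .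
      then have "periodic x ((j + k) - (i + k))" using shift_self_period x that(1) by (metis add_less_cancel_right)
      then show False using per_le that by fastforce
    qed
    have "inj_on (\<lambda>i. fac x i k) {..<per x}"
      by (rule inj_onI) (metis * lessThan_iff linorder_neqE_nat)
    then have "card (facs x k) = per x" by (simp add: facs_image[OF periodic_per[OF x]] card_image)
    then show ?thesis using True by simp
  next
    case False
    then show ?thesis using Suc card_facs_mono[OF x, of k] by simp
  qed
qed

text \<open>The same argument for two sequences: as long as they share a factor of length \<open>k\<close>, unique extension
would make them shifts of each other, so the number of factors of either grows. This is a form of the
theorem of Fine and Wilf.\<close>

lemma card_union_lower:
  assumes x: "cyclic x" and y: "cyclic y" and neq: "\<not> shift_eq x y"
  shows "facs x k \<inter> facs y k \<noteq> {} \<Longrightarrow> k + 2 \<le> card (facs x (Suc k) \<union> facs y (Suc k))"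
proof (induction k)
  let ?U = "\<lambda>k. facs x k \<union> facs y k"
  have fin: "finite (?U k)" for k using finite_facs x y by blast
  have bl: "butlast ` ?U (Suc k) = ?U k" for k by (simp add: image_Un butlast_facs)
  have step: "card (?U k) < card (?U (Suc k))" if ne: "facs x k \<inter> facs y k \<noteq> {}" for k
  proof -
    have "card (?U k) \<le> card (?U (Suc k))" using bl card_image_le fin by metis
    moreover have "card (?U k) \<noteq> card (?U (Suc k))"
    proof
      assume "card (?U k) = card (?U (Suc k))"
      then have inj: "inj_on butlast (?U (Suc k))" by (intro eq_card_imp_inj_on fin) (simp add: bl)
      obtain a b where "fac x a k = fac y b k" using ne by (auto simp: facs_def)
      then have "x (a + k + t) = y (b + k + t)" for t
        using unique_extension[OF inj] by blast
      then show False using neq shift_eq_def by blast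
    qed
    ultimately show ?thesis by simp
  qed
  { case 0
    have "facs x 0 = {[]}" "facs y 0 = {[]}" by (auto simp: facs_def fac_def)
    then show ?case using step[of 0] by simp
  next
    case (Suc k)
    then obtain a b where "fac x a (Suc k) = fac y b (Suc k)" by (auto simp: facs_def)
    then have "fac x a k = fac y b k" by (simp add: fac_eq_iff)
    then have "facs x k \<inter> facs y k \<noteq> {}" using fac_in_facs by (metis disjoint_iff)
    then show ?case using Suc.IH step[OF Suc.prems] by simp }
qed

section \<open>Full circuits in a Rauzy graph\<close>

text \<open>Connectedness is stated by cuts and conservation of flow by potentials: both hypotheses pass to the
contraction of an edge by composing with the contraction map. A connected graph with one edge fewer than
vertices is a tree, and a tree carries no flow.\<close>

lemma connected_graph_flow:
  fixes s t :: "'e \<Rightarrow> 'v"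
  assumes "finite V" "finite E" "V \<noteq> {}" "s ` E \<subseteq> V" "t ` E \<subseteq> V"
    and "\<And>A. (\<forall>e\<in>E. s e \<in> A \<longleftrightarrow> t e \<in> A) \<Longrightarrow> V \<subseteq> A \<or> V \<inter> A = {}"
  shows "card V \<le> card E + 1 \<and> (card V = card E + 1 \<longrightarrow>
    (\<forall>X :: 'e \<Rightarrow> int. (\<forall>h :: 'v \<Rightarrow> int. (\<Sum>e\<in>E. X e * (h (t e) - h (s e))) = 0) \<longrightarrow> (\<forall>e\<in>E. X e = 0)))"
  using assms
proof (induction "card V" arbitrary: V E s t)
  case 0
  then show ?case by simp
next
  case (Suc n)
  note fin = \<open>finite V\<close> \<open>finite E\<close> and conn = Suc.prems(6)
  show ?case
  proof (cases "n = 0")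
    case True
    then show ?thesis using Suc by auto
  next
    case False
    obtain v where v: "v \<in> V" using Suc.prems by auto
    have "\<not> V \<subseteq> {v}" using False Suc.hyps(2) by (metis One_nat_def Suc_inject card_1_singleton_iff subset_singletonD v empty_iff)
    then have "\<not> (\<forall>e\<in>E. s e \<in> {v} \<longleftrightarrow> t e \<in> {v})" using conn[of "{v}"] v by blast
    then obtain e where e: "e \<in> E" "s e \<noteq> t e" by auto
    define f where "f = (\<lambda>x. if x = t e then s e else x)"
    define V' where "V' = V - {t e}"
    define E' where "E' = E - {e}"
    have st: "s e \<in> V" "t e \<in> V" using e Suc.prems by auto
    have cV: "n = card V'" using Suc.hyps(2) fin st by (simp add: V'_def)
    have cE: "card E = Suc (card E')" using fin e unfolding E'_def by (metis card_Suc_Diff1)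
    have fV: "f x \<in> V'" if "x \<in> V" for x using that st e by (auto simp: f_def V'_def)
    have conn': "V' \<subseteq> A \<or> V' \<inter> A = {}" if A: "\<forall>x\<in>E'. (f \<circ> s) x \<in> A \<longleftrightarrow> (f \<circ> t) x \<in> A" for A
    proof -
      have "\<forall>x\<in>E. s x \<in> f -` A \<longleftrightarrow> t x \<in> f -` A"
        using A e by (metis E'_def DiffI comp_apply f_def singletonD vimage_eq)
      then have "V \<subseteq> f -` A \<or> V \<inter> f -` A = {}" by (rule conn)
      moreover have "f x = x" if "x \<in> V'" for x using that by (auto simp: f_def V'_def)
      ultimately show ?thesis unfolding V'_def by fastforce
    qed
    have IH: "card V' \<le> card E' + 1 \<and> (card V' = card E' + 1 \<longrightarrow>
        (\<forall>X :: 'e \<Rightarrow> int. (\<forall>h :: 'v \<Rightarrow> int. (\<Sum>x\<in>E'. X x * (h ((f \<circ> t) x) - h ((f \<circ> s) x))) = 0) \<longrightarrow> (\<forall>x\<in>E'. X x = 0)))"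
    proof (rule Suc.hyps(1)[OF cV])
      show "V' \<noteq> {}" using st e by (auto simp: V'_def)
      show "(f \<circ> s) ` E' \<subseteq> V'" "(f \<circ> t) ` E' \<subseteq> V'"
        using fV Suc.prems(4,5) by (auto simp: E'_def)
      show "V' \<subseteq> A \<or> V' \<inter> A = {}" if "\<forall>e\<in>E'. (f \<circ> s) e \<in> A \<longleftrightarrow> (f \<circ> t) e \<in> A" for A
        using conn' that by blast
    qed (use fin in \<open>auto simp: V'_def E'_def\<close>)
    show ?thesis
    proof (intro conjI impI allI)
      show "card V \<le> card E + 1" using IH cV cE Suc.hyps(2) by linarith
    next
      fix X :: "'e \<Rightarrow> int"
      assume tree: "card V = card E + 1"
        and flow: "\<forall>h :: 'v \<Rightarrow> int. (\<Sum>e\<in>E. X e * (h (t e) - h (s e))) = 0"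
      have split: "(\<Sum>x\<in>E. g x) = g e + (\<Sum>x\<in>E'. g x)" for g :: "'e \<Rightarrow> int"
        using e fin unfolding E'_def by (simp add: sum.remove)
      have "(\<Sum>x\<in>E'. X x * (h ((f \<circ> t) x) - h ((f \<circ> s) x))) = 0" for h :: "'v \<Rightarrow> int"
        using flow[rule_format, of "h \<circ> f"] e by (simp add: split f_def)
      then have zero: "\<forall>x\<in>E'. X x = 0" using IH tree cV cE Suc.hyps(2) by simp
      then have "X e = 0"
        using flow[rule_format, of "\<lambda>x. if x = t e then 1 else 0"] e by (simp add: split)
      then show "\<forall>x\<in>E. X x = 0" using zero by (auto simp: E'_def)
    qed
  qed
qed

text \<open>The sequences in \<open>I\<close> represent distinct circuits whose edges all occur in the Rauzy graph of order \<open>k\<close>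
of \<open>W\<close>.\<close>

locale full_circuits =
  fixes W :: "nat \<Rightarrow> 'a" and I :: "(nat \<Rightarrow> 'a) set" and k :: nat
  assumes cyclic_W: "cyclic W"
    and finite_I: "finite I"
    and cyclic_I: "p \<in> I \<Longrightarrow> cyclic p"
    and per_le_I: "p \<in> I \<Longrightarrow> per p \<le> Suc k"
    and full_I: "p \<in> I \<Longrightarrow> facs p (Suc k) \<subseteq> facs W (Suc k)"
    and distinct_I: "p \<in> I \<Longrightarrow> q \<in> I \<Longrightarrow> shift_eq p q \<Longrightarrow> p = q"
begin

abbreviation "edges p \<equiv> facs p (Suc k)"
abbreviation "verts p \<equiv> facs p k"

definition priv :: "(nat \<Rightarrow> 'a) \<Rightarrow> 'a list" where
  "priv p = (SOME e. e \<in> edges p \<and> (\<forall>q\<in>I. per q \<le> per p \<and> e \<in> edges q \<longrightarrow> q = p))"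

lemma priv:
  assumes "p \<in> I"
  shows "priv p \<in> edges p" and "q \<in> I \<Longrightarrow> per q \<le> per p \<Longrightarrow> priv p \<in> edges q \<Longrightarrow> q = p"
proof -
  obtain e where "e \<in> edges p" "\<forall>y. cyclic y \<and> per y \<le> per p \<and> e \<in> edges y \<longrightarrow> shift_eq p y"
    using private_factor[OF cyclic_I per_le_I] assms by blast
  then have "\<exists>e. e \<in> edges p \<and> (\<forall>q\<in>I. per q \<le> per p \<and> e \<in> edges q \<longrightarrow> q = p)"
    using distinct_I assms cyclic_I by metis
  from someI_ex[OF this] show "priv p \<in> edges p"
    and "q \<in> I \<Longrightarrow> per q \<le> per p \<Longrightarrow> priv p \<in> edges q \<Longrightarrow> q = p"
    unfolding priv_def by blast+
qed

lemma inj_priv: "inj_on priv I"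
  by (rule inj_onI) (metis priv nle_le)

text \<open>The circuits are added in the order of decreasing length, because a private edge of \<open>q\<close> can lie only on those other
circuits that are longer than \<open>q\<close>.\<close>

lemma longest_first_induct [consumes 2, case_names empty insert]:
  assumes "finite J" "J \<subseteq> I" "P {}"
    and "\<And>p J. finite J \<Longrightarrow> J \<subseteq> I \<Longrightarrow> p \<in> I \<Longrightarrow> p \<notin> J \<Longrightarrow> (\<And>q. q \<in> J \<Longrightarrow> per p \<le> per q) \<Longrightarrow> P J \<Longrightarrow> P (insert p J)"
  shows "P J"
proof -
  have "J \<subseteq> I \<longrightarrow> P J"
    using assms(1)
  proof (induction rule: finite_ranking_induct[where f = "\<lambda>p. - int (per p)"])
    case empty
    then show ?case using assms(3) by simp
  next
    case (insert p S)
    then show ?case using assms(4)[of S p] by (cases "p \<in> S") (auto simp: insert_absorb)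
  qed
  then show ?thesis using assms(2) by simp
qed

lemma cut_trivial:
  assumes A: "\<forall>e\<in>edges W. butlast e \<in> A \<longleftrightarrow> tl e \<in> A"
  shows "verts W \<subseteq> A \<or> verts W \<inter> A = {}"
proof -
  have "fac W i k \<in> A \<longleftrightarrow> fac W 0 k \<in> A" for i
  proof (induction i)
    case (Suc i)
    then show ?case using A[rule_format, of "fac W i (Suc k)"] by (simp add: butlast_fac tl_fac)
  qed simp
  then show ?thesis unfolding facs_def by blast
qed

text \<open>When the private edge of \<open>p\<close> is deleted, the rest of the circuit \<open>p\<close> still joins its two ends: the
private edges deleted before belong to circuits that are at least as long, hence do not lie on \<open>p\<close>.\<close>

lemma cut_trivial_minus_priv:
  assumes "J \<subseteq> I" and "\<forall>e\<in>edges W - priv ` J. butlast e \<in> A \<longleftrightarrow> tl e \<in> A"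
  shows "verts W \<subseteq> A \<or> verts W \<inter> A = {}"
proof -
  have "finite J" using finite_I assms finite_subset by blast
  then show ?thesis
    using assms
  proof (induction rule: longest_first_induct)
    case empty
    then show ?case using cut_trivial by simp
  next
    case (insert p J)
    note A = insert.prems
    obtain j where j: "priv p = fac p j (Suc k)" using priv(1)[OF \<open>p \<in> I\<close>] by (auto simp: facs_def)
    have pp: "periodic p (per p)" using cyclic_I insert.hyps periodic_per by blast
    have step: "fac p (j + i) k \<in> A \<longleftrightarrow> fac p (Suc (j + i)) k \<in> A" if i: "0 < i" "i < per p" for i
    proof -
      let ?e = "fac p (j + i) (Suc k)"
      have "?e \<noteq> priv p"
      proof
        assume "?e = priv p"
        then have "p (j + t) = p (j + i + t)" for t
          using agree_all[OF pp pp per_le_I[OF \<open>p \<in> I\<close>]] j by metis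
        then have "periodic p i"
          using shift_self_period[of p j "j + i"] cyclic_I \<open>p \<in> I\<close> i by simp
        then show False using per_le i by fastforce
      qed
      moreover have "?e \<noteq> priv q" if "q \<in> J" for q
        using priv(2)[of q p] insert.hyps that by (metis fac_in_facs subsetD)
      moreover have "?e \<in> edges W" using full_I[OF \<open>p \<in> I\<close>] by auto
      ultimately have "?e \<in> edges W - priv ` insert p J" by auto
      then show ?thesis using A by (metis butlast_fac tl_fac)
    qed
    have "i < per p \<Longrightarrow> fac p (j + 1) k \<in> A \<longleftrightarrow> fac p (Suc (j + i)) k \<in> A" for i
    proof (induction i)
      case (Suc i)
      then show ?case using step[of "Suc i"] by simp
    qed simp
    from this[of "per p - 1"] have "fac p (j + 1) k \<in> A \<longleftrightarrow> fac p (j + per p) k \<in> A"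
      using per_pos[OF cyclic_I[OF \<open>p \<in> I\<close>]] by simp
    moreover have "fac p (j + per p) k = fac p j k"
      using fac_mod[OF pp, of "j + per p"] fac_mod[OF pp, of j] by simp
    ultimately have "butlast (priv p) \<in> A \<longleftrightarrow> tl (priv p) \<in> A"
      by (simp add: j butlast_fac tl_fac)
    then show ?case using insert.IH A by blast
  qed
qed

text \<open>After the deletion of the private edges, at least \<open>card (verts W) - 1\<close> edges are left. In case of equality
they form a tree, and a flow is determined by its values on the private edges.\<close>

lemma rauzy_card: "card I + card (verts W) \<le> card (edges W) + 1"
  and rauzy_flow: "card I + card (verts W) = card (edges W) + 1 \<Longrightarrow>
    (\<And>h :: 'a list \<Rightarrow> int. (\<Sum>e\<in>edges W. X e * (h (tl e) - h (butlast e))) = 0) \<Longrightarrow>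
    (\<And>p. p \<in> I \<Longrightarrow> X (priv p) = 0) \<Longrightarrow> e \<in> edges W \<Longrightarrow> X e = (0 :: int)"
proof -
  let ?R = "edges W - priv ` I"
  have fin: "finite (edges W)" "finite (verts W)" using cyclic_W finite_facs by blast+
  have sub: "priv ` I \<subseteq> edges W" using priv(1) full_I by blast
  have cR: "card ?R + card I = card (edges W)"
    using card_Diff_subset[OF finite_subset[OF sub fin(1)] sub] card_mono[OF fin(1) sub] card_image[OF inj_priv] by simp
  have g: "card (verts W) \<le> card ?R + 1 \<and> (card (verts W) = card ?R + 1 \<longrightarrow>
    (\<forall>X :: 'a list \<Rightarrow> int. (\<forall>h :: 'a list \<Rightarrow> int. (\<Sum>e\<in>?R. X e * (h (tl e) - h (butlast e))) = 0) \<longrightarrow> (\<forall>e\<in>?R. X e = 0)))"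
  proof (rule connected_graph_flow)
    show "verts W \<noteq> {}" by (auto simp: facs_def)
    show "butlast ` ?R \<subseteq> verts W" using butlast_facs[of W k] by blast
    show "tl ` ?R \<subseteq> verts W" by (auto simp: facs_def tl_fac)
    show "verts W \<subseteq> A \<or> verts W \<inter> A = {}" if "\<forall>e\<in>?R. butlast e \<in> A \<longleftrightarrow> tl e \<in> A" for A
      using cut_trivial_minus_priv[OF order_refl that] .
  qed (use fin in auto)
  show "card I + card (verts W) \<le> card (edges W) + 1" using g cR by linarith
  assume tight: "card I + card (verts W) = card (edges W) + 1"
    and flow: "\<And>h :: 'a list \<Rightarrow> int. (\<Sum>e\<in>edges W. X e * (h (tl e) - h (butlast e))) = 0"
    and zero: "\<And>p. p \<in> I \<Longrightarrow> X (priv p) = 0" and e: "e \<in> edges W"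
  have "(\<Sum>e\<in>?R. X e * (h (tl e) - h (butlast e))) = 0" for h :: "'a list \<Rightarrow> int"
    using sum.mono_neutral_left[of "edges W" ?R "\<lambda>e. X e * (h (tl e) - h (butlast e))"] fin flow[of h] zero by auto
  moreover have "card (verts W) = card ?R + 1" using tight cR by linarith
  ultimately have "\<forall>e\<in>?R. X e = 0" using g by blast
  then show "X e = 0" using zero e by blast
qed

lemma triangular_solution:
  assumes "J \<subseteq> I"
  shows "\<exists>c :: (nat \<Rightarrow> 'a) \<Rightarrow> int. \<forall>p\<in>J. (\<Sum>q\<in>J. c q * of_bool (priv p \<in> edges q)) = T (priv p)"
  using finite_subset[OF assms finite_I] assms
proof (induction rule: longest_first_induct)
  case empty
  then show ?case by simp
next
  case (insert p J)
  then obtain c :: "(nat \<Rightarrow> 'a) \<Rightarrow> int" where c: "\<forall>r\<in>J. (\<Sum>q\<in>J. c q * of_bool (priv r \<in> edges q)) = T (priv r)" by blast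
  define c' where "c' = c(p := T (priv p) - (\<Sum>q\<in>J. c q * of_bool (priv p \<in> edges q)))"
  have J: "(\<Sum>q\<in>J. c' q * of_bool (priv r \<in> edges q)) = (\<Sum>q\<in>J. c q * of_bool (priv r \<in> edges q))" for r
    using insert.hyps by (intro sum.cong) (auto simp: c'_def)
  have "priv r \<notin> edges p" if "r \<in> J" for r
    using priv(2)[of r p] insert.hyps that by blast
  then have "(\<Sum>q\<in>insert p J. c' q * of_bool (priv r \<in> edges q)) = T (priv r)" if "r \<in> insert p J" for r
    using that c J[of r] insert.hyps priv(1)[of p] by (auto simp: c'_def)
  then show ?case by blast
qed

definition occ :: "'a list \<Rightarrow> int" where
  "occ e = int (card {i. i < per W \<and> fac W i (Suc k) = e})"

lemma sum_occ: "(\<Sum>e\<in>edges W. occ e * g e) = (\<Sum>i<per W. g (fac W i (Suc k)))"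
proof -
  have "(\<Sum>i<per W. g (fac W i (Suc k))) = (\<Sum>e\<in>edges W. \<Sum>i\<in>{i\<in>{..<per W}. fac W i (Suc k) = e}. g (fac W i (Suc k)))"
    using cyclic_W finite_facs by (intro sum.group[symmetric]) auto
  also have "\<dots> = (\<Sum>e\<in>edges W. occ e * g e)"
    by (intro sum.cong) (auto simp: occ_def)
  finally show ?thesis by simp
qed

lemma circuit_flow:
  assumes "cyclic p"
  shows "(\<Sum>i<per p. h (tl (fac p i (Suc k))) - h (butlast (fac p i (Suc k)))) = (0 :: int)"
proof -
  have "(\<Sum>i<per p. h (tl (fac p i (Suc k))) - h (butlast (fac p i (Suc k)))) = h (fac p (per p) k) - h (fac p 0 k)"
    using sum_lessThan_telescope[of "\<lambda>i. h (fac p i k)"] by (simp add: tl_fac butlast_fac)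
  also have "fac p (per p) k = fac p 0 k"
    using fac_mod[OF periodic_per[OF assms], of "per p" k] by simp
  finally show ?thesis by simp
qed

lemma sum_edges:
  assumes "p \<in> I"
  shows "(\<Sum>e\<in>edges p. g e) = (\<Sum>i<per p. g (fac p i (Suc k)))"
  using facs_image[OF periodic_per[OF cyclic_I[OF assms]]] sum.reindex[OF fac_inj[OF cyclic_I[OF assms] per_le_I[OF assms]]]
  by simp

lemma sum_edges_W:
  fixes g :: "'a list \<Rightarrow> int"
  assumes "p \<in> I"
  shows "(\<Sum>e\<in>edges W. of_bool (e \<in> edges p) * g e) = (\<Sum>e\<in>edges p. g e)"
proof -
  have "(\<Sum>e\<in>edges W. of_bool (e \<in> edges p) * g e) = (\<Sum>e\<in>edges W \<inter> edges p. g e)"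
    using cyclic_W finite_facs by (subst sum.inter_restrict) (auto intro: sum.cong)
  also have "edges W \<inter> edges p = edges p" using full_I[OF assms] by blast
  finally show ?thesis .
qed

text \<open>The coefficients are chosen to match \<open>occ\<close> on the private edges; the difference is a flow that vanishes
there.\<close>

lemma circuits_span:
  assumes tight: "card I + card (verts W) = card (edges W) + 1"
  shows "\<exists>c :: (nat \<Rightarrow> 'a) \<Rightarrow> int. \<forall>e\<in>edges W. (\<Sum>q\<in>I. c q * of_bool (e \<in> edges q)) = occ e"
proof -
  obtain c :: "(nat \<Rightarrow> 'a) \<Rightarrow> int" where c: "\<forall>p\<in>I. (\<Sum>q\<in>I. c q * of_bool (priv p \<in> edges q)) = occ (priv p)"
    using triangular_solution[OF order_refl] by blast
  define X where "X e = occ e - (\<Sum>q\<in>I. c q * of_bool (e \<in> edges q))" for e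
  have "X e = 0" if "e \<in> edges W" for e
  proof (rule rauzy_flow[OF tight _ _ that])
    fix h :: "'a list \<Rightarrow> int"
    let ?g = "\<lambda>e. h (tl e) - h (butlast e)"
    have "(\<Sum>e\<in>edges W. (\<Sum>q\<in>I. c q * of_bool (e \<in> edges q)) * ?g e)
        = (\<Sum>q\<in>I. c q * (\<Sum>e\<in>edges W. of_bool (e \<in> edges q) * ?g e))"
      by (simp only: sum_distrib_right sum_distrib_left mult.assoc) (rule sum.swap)
    also have "\<dots> = 0"
    proof (intro sum.neutral ballI)
      fix q assume q: "q \<in> I"
      show "c q * (\<Sum>e\<in>edges W. of_bool (e \<in> edges q) * ?g e) = 0"
        using sum_edges_W[OF q, of ?g] sum_edges[OF q, of ?g] circuit_flow[OF cyclic_I[OF q], of h] by simp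
    qed
    finally show "(\<Sum>e\<in>edges W. X e * ?g e) = 0"
      using sum_occ[of ?g] circuit_flow[OF cyclic_W, of h] by (simp only: X_def left_diff_distrib sum_subtractf)
  qed (use c in \<open>simp add: X_def\<close>)
  then show ?thesis unfolding X_def by (intro exI[of _ c]) simp
qed

end

section \<open>Long circuits are not tight\<close>

text \<open>With \<open>a = b = 1\<close> both lengths are \<open>n / 2\<close>; with \<open>a = 1\<close> and \<open>b = 2\<close> the length \<open>y\<close> is below \<open>n / 3\<close>, hence at
most \<open>n / 4\<close>, which leaves \<open>x = n / 2\<close>. All larger weights exceed \<open>n\<close>.\<close>

lemma two_weights:
  fixes a b x y n L :: int
  assumes "a \<ge> 1" "b \<ge> 1" "a * x + b * y = n" "x + y \<ge> L + 1" "3 * L > 2 * n"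
    and "2 * x \<le> n" "2 * y \<le> n" "3 * x \<ge> L" "3 * y \<ge> L"
    and "2 * x < L \<Longrightarrow> 4 * x \<le> n" "2 * y < L \<Longrightarrow> 4 * y \<le> n" "n \<ge> 1"
  shows "x = y \<or> x = 2 * y \<or> y = 2 * x"
proof -
  have pos: "x \<ge> 0" "y \<ge> 0" using assms by linarith+
  have m: "u * z \<ge> i * z" if "u \<ge> i" "z \<ge> 0" for u i z :: int
    using that by (rule mult_right_mono)
  consider "a = 1" "b = 1" | "a = 1" "b = 2" | "a = 2" "b = 1" | "b \<ge> 3" | "a \<ge> 3" | "a \<ge> 2" "b \<ge> 2"
    using assms(1,2) by linarith
  then show ?thesis
  proof cases
    case 1
    then show ?thesis using assms by simp
  next
    case 2
    then have sum: "x + 2 * y = n" using assms(3) by simp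
    then have "4 * y \<le> n" using assms by linarith
    then have "x = 2 * y" using sum assms by linarith
    then show ?thesis by blast
  next
    case 3
    then have sum: "2 * x + y = n" using assms(3) by simp
    then have "4 * x \<le> n" using assms by linarith
    then have "y = 2 * x" using sum assms by linarith
    then show ?thesis by blast
  next
    case 4
    then show ?thesis using assms m[of 3 b y] m[of 1 a x] pos by linarith
  next
    case 5
    then show ?thesis using assms m[of 1 b y] m[of 3 a x] pos by linarith
  next
    case 6
    then show ?thesis using assms m[of 2 b y] m[of 2 a x] pos by linarith
  qed
qed

text \<open>Here \<open>y\<close> and \<open>z\<close> are below \<open>n / 3\<close>, hence at most \<open>n / 4\<close>, and larger weights would exceed \<open>n\<close>.
With all weights \<open>1\<close>, the sum is \<open>n\<close> only for \<open>x = n / 2\<close> and \<open>y = z = n / 4\<close>.\<close>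

lemma three_weights:
  fixes a b c x y z n L :: int
  assumes "a \<ge> 1" "b \<ge> 1" "c \<ge> 1" "a * x + b * y + c * z = n"
    and "x + y \<ge> L + 1" "x + z \<ge> L + 1" "3 * L > 2 * n"
    and "2 * x \<le> n" "3 * x \<ge> L" "3 * y \<ge> L" "3 * z \<ge> L"
    and "2 * y < L \<Longrightarrow> 4 * y \<le> n" "2 * z < L \<Longrightarrow> 4 * z \<le> n" "n \<ge> 1"
  shows "x = 2 * y"
proof -
  have pos: "x \<ge> 0" "y \<ge> 0" "z \<ge> 0" using assms by linarith+
  have m: "u * v \<ge> i * v" if "u \<ge> i" "v \<ge> 0" for u i v :: int
    using that by (rule mult_right_mono)
  note m1 = m[OF assms(1) pos(1)] m[OF assms(2) pos(2)] m[OF assms(3) pos(3)]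
  have "a = 1" using m[of 2 a x] m1 assms pos by (smt (verit))
  moreover have "b = 1" using m[of 2 b y] m1 assms pos by (smt (verit))
  moreover have "c = 1" using m[of 2 c z] m1 assms pos by (smt (verit))
  ultimately have sum: "x + y + z = n" using assms(4) by simp
  then have "4 * y \<le> n" "4 * z \<le> n" using assms by linarith+
  then show ?thesis using sum assms(8) by linarith
qed

text \<open>The two alternatives in \<open>lengths\<close> come from squares whose roots are the first or the second power of a
primitive word; for higher powers \<open>L\<close> is at most \<open>2 * n / 3\<close>.\<close>

locale tight_circuits = full_circuits +
  assumes long: "2 * per W < 3 * Suc k"
    and Suc_k_le: "Suc k \<le> per W"
    and lengths: "p \<in> I \<Longrightarrow>
      Suc k \<le> 2 * per p \<and> 2 * per p \<le> per W \<or> Suc k \<le> 3 * per p \<and> 4 * per p \<le> per W"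
    and tight: "card I + card (verts W) = card (edges W) + 1"
begin

abbreviation "n \<equiv> per W"

lemma long': "2 * n < 3 * k + 3"
  using long by simp

lemma half: "p \<in> I \<Longrightarrow> 2 * per p \<le> n" and third: "p \<in> I \<Longrightarrow> Suc k \<le> 3 * per p"
  and quarter: "p \<in> I \<Longrightarrow> 2 * per p < Suc k \<Longrightarrow> 4 * per p \<le> n"
  using lengths[of p] by linarith+

lemma card_edges: "p \<in> I \<Longrightarrow> card (edges p) = per p"
  using card_facs_eq cyclic_I per_le_I by blast

text \<open>For all orders from \<open>n div 2\<close> to \<open>k\<close> the circuits stay full and not longer than the edges, so each step
increases the number of factors by at least \<open>card I - 1\<close>. With four circuits, these more than \<open>n / 6\<close>
steps of at least three would lead beyond \<open>n\<close>.\<close>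

lemma card_I_le: "card I \<le> 3"
proof -
  let ?h = "n div 2"
  have step: "card I + card (facs W j) \<le> card (facs W (Suc j)) + 1" if j: "?h \<le> j" "j \<le> k" for j
  proof -
    interpret j: full_circuits W I j
    proof
      show "per p \<le> Suc j" if "p \<in> I" for p using half[OF that] j by linarith
      show "facs p (Suc j) \<subseteq> facs W (Suc j)" if "p \<in> I" for p
        using facs_mono[OF full_I[OF that]] j by simp
    qed (use cyclic_W finite_I cyclic_I distinct_I in auto)
    show ?thesis by (rule j.rauzy_card)
  qed
  have grow: "?h + i \<le> Suc k \<Longrightarrow> card (facs W ?h) + i * card I \<le> card (facs W (?h + i)) + i" for i
  proof (induction i)
    case (Suc i)
    then show ?case using step[of "?h + i"] by simp
  qed simp
  have "n > 0" using per_pos cyclic_W by blast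
  then have "Suc ?h \<le> card (facs W ?h)" using card_facs_lower[OF cyclic_W, of ?h] by simp
  moreover have "card (facs W (Suc k)) \<le> n"
    using card_facs_le periodic_per cyclic_W by blast
  moreover define i where "i = Suc k - ?h"
  moreover have hi: "?h + i = Suc k" using long' Suc_k_le \<open>n > 0\<close> unfolding i_def by linarith
  ultimately have bound: "Suc ?h + i * card I \<le> n + i"
    using grow[of i, unfolded hi] by linarith
  show ?thesis
  proof (rule ccontr)
    assume "\<not> card I \<le> 3"
    then have "i * 4 \<le> i * card I" by simp
    then show False using bound hi long' by linarith
  qed
qed

lemma share_bound:
  assumes "p \<in> I" "q \<in> I" "p \<noteq> q" "verts p \<inter> verts q \<noteq> {}"
  shows "Suc k + 1 + card (edges p \<inter> edges q) \<le> per p + per q"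
proof -
  have "k + 2 \<le> card (edges p \<union> edges q)"
    using card_union_lower assms cyclic_I distinct_I by blast
  moreover have "card (edges p) + card (edges q) = card (edges p \<union> edges q) + card (edges p \<inter> edges q)"
    using assms cyclic_I finite_facs by (intro card_Un_Int) blast+
  ultimately show ?thesis using card_edges assms by simp
qed

text \<open>Here \<open>per p\<close> is a period of both circuits and fits into a common vertex.\<close>

lemma no_common_period:
  assumes "p \<in> I" "q \<in> I" "p \<noteq> q" "verts p \<inter> verts q \<noteq> {}" "per q dvd per p"
  shows False
proof -
  have "periodic p (per p)" using periodic_per cyclic_I assms by blast
  moreover have "periodic q (per p)"
    using periodic_mult_period[OF periodic_per[OF cyclic_I[OF assms(2)]]] assms(5) per_pos[OF cyclic_I[OF assms(1)]]
    by (metis dvd_def mult.commute mult_0 neq0_conv)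
  moreover have "per p \<le> k" using half[OF assms(1)] long' Suc_k_le by linarith
  ultimately show False using shift_eq_common_period assms distinct_I by blast
qed

lemma edge_in_both: "e \<in> edges p \<Longrightarrow> e \<in> edges q \<Longrightarrow> verts p \<inter> verts q \<noteq> {}"
  using butlast_facs by (metis disjoint_iff image_eqI)

lemma not_edges_subset:
  assumes "p \<in> I" "q \<in> I" "p \<noteq> q"
  shows "\<not> edges p \<subseteq> edges q"
proof
  assume sub: "edges p \<subseteq> edges q"
  then have "edges p \<inter> edges q = edges p" by blast
  moreover have "verts p \<inter> verts q \<noteq> {}" using edge_in_both sub fac_in_facs by (metis subsetD)
  ultimately show False using share_bound[OF assms] card_edges assms per_le_I by fastforce
qed

text \<open>The walk of \<open>W\<close> is written as a combination of the circuits. First the coefficients are shown to be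
nonnegative, then the at most three circuits with positive coefficient are treated by their number.\<close>

lemma contradiction: False
proof -
  obtain c :: "(nat \<Rightarrow> 'a) \<Rightarrow> int"
    where c: "\<And>e. e \<in> edges W \<Longrightarrow> (\<Sum>q\<in>I. c q * of_bool (e \<in> edges q)) = occ e"
    using circuits_span[OF tight] by blast
  have occ_pos: "occ e \<ge> 1" if e: "e \<in> edges W" for e
  proof -
    obtain i where "i < n" "fac W i (Suc k) = e"
      using e facs_image[OF periodic_per[OF cyclic_W]] by auto
    then have "{i. i < n \<and> fac W i (Suc k) = e} \<noteq> {}" by blast
    then have "card {i. i < n \<and> fac W i (Suc k) = e} > 0" by (simp add: card_gt_0_iff)
    then show ?thesis unfolding occ_def by linarith
  qed
  have total: "(\<Sum>q\<in>I. c q * int (per q)) = int n"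
  proof -
    have "(\<Sum>q\<in>I. c q * int (per q)) = (\<Sum>q\<in>I. c q * (\<Sum>e\<in>edges W. of_bool (e \<in> edges q) * 1))"
      by (intro sum.cong refl) (simp add: sum_edges_W card_edges del: mult_1_right)
    also have "\<dots> = (\<Sum>e\<in>edges W. \<Sum>q\<in>I. c q * of_bool (e \<in> edges q))"
      by (simp only: sum_distrib_left mult_1_right) (rule sum.swap)
    also have "\<dots> = (\<Sum>e\<in>edges W. occ e * 1)" using c by simp
    also have "\<dots> = int n" by (simp only: sum_occ) simp
    finally show ?thesis .
  qed
  have n: "n > 0" using per_pos cyclic_W by blast
  have cover: "\<exists>q\<in>I. e \<in> edges q \<and> c q > 0" if "e \<in> edges W" for e
  proof (rule ccontr)
    assume "\<not> ?thesis"
    then have "(\<Sum>q\<in>I. c q * of_bool (e \<in> edges q)) \<le> 0" by (intro sum_nonpos) (auto simp: not_less)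
    then show False using c occ_pos that by fastforce
  qed
  \<comment> \<open>A circuit \<open>p\<close> with a negative coefficient is covered by two others; as each of them shares only a short part of \<open>p\<close>, all three are long, and the coefficients of the other two make the total exceed \<open>n\<close>.\<close>
  have nonneg: "c p \<ge> 0" if p: "p \<in> I" for p
  proof (rule ccontr)
    assume neg: "\<not> c p \<ge> 0"
    have cov: "\<exists>q\<in>I. e \<in> edges q \<and> c q > 0" if "e \<in> edges p" for e
      using cover full_I[OF p] that by blast
    obtain q where q: "q \<in> I" "c q > 0" "fac p 0 (Suc k) \<in> edges q" using cov[OF fac_in_facs] by blast
    have "q \<noteq> p" using q neg by auto
    obtain e1 where e1: "e1 \<in> edges p" "e1 \<notin> edges q"
      using not_edges_subset[OF p q(1)] \<open>q \<noteq> p\<close> by blast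
    obtain r where r: "r \<in> I" "c r > 0" "e1 \<in> edges r" using cov e1 by blast
    have "r \<noteq> p" "r \<noteq> q" using r neg e1 by auto
    obtain e2 where e2: "e2 \<in> edges p" "e2 \<notin> edges r"
      using not_edges_subset[OF p r(1)] \<open>r \<noteq> p\<close> by blast
    have I: "I = {p, q, r}"
      by (rule card_seteq[symmetric]) (use finite_I p q r card_I_le \<open>q \<noteq> p\<close> \<open>r \<noteq> p\<close> \<open>r \<noteq> q\<close> in auto)
    note ne = \<open>q \<noteq> p\<close> \<open>r \<noteq> p\<close> \<open>r \<noteq> q\<close> \<open>q \<noteq> p\<close>[symmetric] \<open>r \<noteq> p\<close>[symmetric] \<open>r \<noteq> q\<close>[symmetric]
    have "e1 \<in> edges W" "e2 \<in> edges W" using e1 e2 full_I[OF p] by blast+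
    have pr: "c p + c r \<ge> 1"
      using c[OF \<open>e1 \<in> edges W\<close>] occ_pos[OF \<open>e1 \<in> edges W\<close>] e1 r(3) ne by (simp add: I)
    have "e2 \<in> edges q" using cov[OF e2(1)] e2 neg by (auto simp: I)
    then have pq: "c p + c q \<ge> 1"
      using c[OF \<open>e2 \<in> edges W\<close>] occ_pos[OF \<open>e2 \<in> edges W\<close>] e2 ne by (simp add: I)
    have "edges p \<subseteq> edges p \<inter> edges q \<union> edges p \<inter> edges r"
      using cov neg by (auto simp: I)
    then have "card (edges p) \<le> card (edges p \<inter> edges q \<union> edges p \<inter> edges r)"
      using finite_facs[OF cyclic_I[OF p]] by (intro card_mono) auto
    also have "\<dots> \<le> card (edges p \<inter> edges q) + card (edges p \<inter> edges r)" by (rule card_Un_le)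
    finally have "per p \<le> card (edges p \<inter> edges q) + card (edges p \<inter> edges r)"
      using card_edges[OF p] by simp
    moreover have "Suc k + 1 + card (edges p \<inter> edges q) \<le> per p + per q"
      using share_bound[OF p q(1) ne(4)] edge_in_both[OF fac_in_facs q(3)] by blast
    moreover have "Suc k + 1 + card (edges p \<inter> edges r) \<le> per p + per r"
      using share_bound[OF p r(1) ne(5)] edge_in_both[OF e1(1) r(3)] by blast
    ultimately have big: "2 * int k + 4 \<le> int (per p) + int (per q) + int (per r)" by linarith
    let ?P = "int (per p)" and ?Q = "int (per q)" and ?R = "int (per r)"
    have "(1 - c p) * ?Q \<le> c q * ?Q" "(1 - c p) * ?R \<le> c r * ?R"
      using pq pr by (intro mult_right_mono; simp)+
    \<comment> \<open>By \<open>pq\<close> and \<open>pr\<close> both coefficients are at least \<open>1 - c p\<close>, which is at least \<open>2\<close>.\<close>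
    moreover have "2 * (?Q + ?R - ?P) \<le> (1 - c p) * (?Q + ?R - ?P)"
      using neg big half[OF p] long' by (intro mult_right_mono) linarith+
    moreover have "(1 - c p) * (?Q + ?R - ?P) = (1 - c p) * ?Q + (1 - c p) * ?R - ?P + c p * ?P"
      by (simp add: algebra_simps)
    moreover have "c p * ?P + c q * ?Q + c r * ?R = int n"
      using total ne by (simp add: I)
    ultimately have "2 * (?Q + ?R - ?P) + ?P \<le> int n" by linarith
    moreover have "2 * ?P \<le> int n" "2 * int n < 3 * int k + 3" using half[OF p] long' by linarith+
    moreover have "int k \<ge> 0" by simp
    ultimately show False using big by (smt (verit))
  qed
  define J where "J = {p\<in>I. c p > 0}"
  have J: "finite J" "J \<subseteq> I" "card J \<le> 3" "\<And>p. p \<in> J \<Longrightarrow> c p \<ge> 1"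
    using finite_I card_I_le card_mono[of I J] by (auto simp: J_def)
  have total_J: "(\<Sum>q\<in>J. c q * int (per q)) = int n"
  proof -
    have "(\<Sum>q\<in>J. c q * int (per q)) = (\<Sum>q\<in>I. c q * int (per q))"
      using finite_I nonneg by (intro sum.mono_neutral_left) (force simp: J_def)+
    then show ?thesis using total by simp
  qed
  have cover_J: "\<exists>q\<in>J. e \<in> edges q" if "e \<in> edges W" for e
    using cover[OF that] by (auto simp: J_def)
  \<comment> \<open>The walk of \<open>W\<close> passes through all circuits and can change circuits only at a common vertex.\<close>
  have connect: "\<exists>p\<in>A. \<exists>q\<in>J - A. verts p \<inter> verts q \<noteq> {}" if A: "A \<subseteq> J" "A \<noteq> {}" "J - A \<noteq> {}" for A
  proof (rule ccontr)
    assume sep: "\<not> ?thesis"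
    let ?in = "\<lambda>i. \<exists>p\<in>A. fac W i (Suc k) \<in> edges p"
    have step: "?in (Suc i)" if i: "?in i" for i
    proof -
      obtain p where p: "p \<in> A" "fac W i (Suc k) \<in> edges p" using i by blast
      obtain q where q: "q \<in> J" "fac W (Suc i) (Suc k) \<in> edges q" using cover_J fac_in_facs by blast
      have "fac W (Suc i) k \<in> verts q"
        using q(2) butlast_facs[of q k] by (metis butlast_fac image_eqI)
      moreover have "fac W (Suc i) k \<in> verts p"
      proof -
        obtain j where "fac W i (Suc k) = fac p j (Suc k)" using p by (auto simp: facs_def)
        then have "fac W (Suc i) k = fac p (Suc j) k" by (metis tl_fac)
        then show ?thesis by simp
      qed
      ultimately have "q \<in> A" using sep p q by blast
      then show ?thesis using q by blast
    qed
    obtain p where p: "p \<in> A" using A by blast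
    then have "fac p 0 (Suc k) \<in> edges W" using full_I A J(2) fac_in_facs by blast
    then obtain i0 where "fac p 0 (Suc k) = fac W i0 (Suc k)" by (auto simp: facs_def)
    then have i0: "?in i0" using p fac_in_facs by metis
    have from_i0: "?in (i0 + i)" for i by (induction i) (use i0 step in auto)
    obtain q where q: "q \<in> J - A" using A by blast
    then have "fac q 0 (Suc k) \<in> edges W" using full_I J(2) fac_in_facs by blast
    then obtain j where j: "fac q 0 (Suc k) = fac W j (Suc k)" by (auto simp: facs_def)
    have "fac W (j + i0 * n) (Suc k) = fac W j (Suc k)"
      using fac_mod[OF periodic_per[OF cyclic_W], of "j + i0 * n" "Suc k"] fac_mod[OF periodic_per[OF cyclic_W], of j "Suc k"] by simp
    moreover have "i0 \<le> j + i0 * n" using n by (metis Suc_leI mult.right_neutral mult_le_mono2 One_nat_def trans_le_add2)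
    ultimately have "?in j" using from_i0[of "j + i0 * n - i0"] by simp
    then show False using sep q j edge_in_both by (metis fac_in_facs)
  qed
  have facts: "2 * int (per p) \<le> int n" "int (Suc k) \<le> 3 * int (per p)"
      "2 * int (per p) < int (Suc k) \<Longrightarrow> 4 * int (per p) \<le> int n" "c p \<ge> 1" if "p \<in> J" for p
    using half third quarter J(2,4) that by fastforce+
  have glob: "3 * int (Suc k) > 2 * int n" "int n \<ge> 1" using long n by linarith+
  have bound: "int (per p) + int (per q) \<ge> int (Suc k) + 1" if "p \<in> J" "q \<in> J" "p \<noteq> q" "verts p \<inter> verts q \<noteq> {}" for p q
    using share_bound[of p q] J(2) that by fastforce
  have "card J \<noteq> 0"
    using cover_J[OF fac_in_facs] J(1) by auto
  moreover have "card J \<noteq> 1"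
  proof
    assume "card J = 1"
    then obtain p where p: "J = {p}" by (auto simp: card_1_singleton_iff)
    then have "card (edges W) \<le> card (edges p)"
      using cover_J J(2) cyclic_I finite_facs by (intro card_mono) auto
    moreover have "min (Suc (Suc k)) n \<le> card (edges W)" using card_facs_lower[OF cyclic_W] .
    ultimately show False using card_edges[of p] half[of p] J(2) p Suc_k_le long n by auto
  qed
  moreover have "card J \<noteq> 2"
  proof
    assume "card J = 2"
    then obtain p q where pq: "J = {p, q}" "p \<noteq> q" by (auto simp: card_2_iff)
    then have sh: "verts p \<inter> verts q \<noteq> {}" using connect[of "{p}"] by auto
    have "c p * int (per p) + c q * int (per q) = int n" using total_J pq by simp
    then have "int (per p) = int (per q) \<or> int (per p) = 2 * int (per q) \<or> int (per q) = 2 * int (per p)"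
      using two_weights[OF facts(4)[of p] facts(4)[of q] _ bound glob(1) facts(1)[of p] facts(1)[of q] facts(2)[of p] facts(2)[of q]
          facts(3)[of p] facts(3)[of q] glob(2)] pq sh by simp
    then have "per p = per q \<or> per p = 2 * per q \<or> per q = 2 * per p" by linarith
    then have "per q dvd per p \<or> per p dvd per q" by (metis dvd_refl dvd_triv_right)
    then show False using no_common_period[of p q] no_common_period[of q p] pq sh J(2) by blast
  qed
  moreover have "card J \<noteq> 3"
  proof
    assume "card J = 3"
    then obtain a b d where abd: "J = {a, b, d}" "a \<noteq> b" "a \<noteq> d" "b \<noteq> d" by (auto simp: card_3_iff)
    have ab: "verts a \<inter> verts b \<noteq> {} \<or> verts a \<inter> verts d \<noteq> {}" using connect[of "{a}"] abd by auto
    have bc: "verts b \<inter> verts a \<noteq> {} \<or> verts b \<inter> verts d \<noteq> {}" using connect[of "{b}"] abd by auto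
    have ca: "verts d \<inter> verts a \<noteq> {} \<or> verts d \<inter> verts b \<noteq> {}" using connect[of "{d}"] abd by auto
    \<comment> \<open>Connectedness provides a circuit that meets both others.\<close>
    obtain p q r where pqr: "J = {p, q, r}" "p \<noteq> q" "p \<noteq> r" "q \<noteq> r"
      and sh: "verts p \<inter> verts q \<noteq> {}" "verts p \<inter> verts r \<noteq> {}"
    proof (cases "verts a \<inter> verts b \<noteq> {}")
      case True
      show thesis
      proof (cases "verts a \<inter> verts d \<noteq> {}")
        case True
        then show thesis using that[of a b d] abd \<open>verts a \<inter> verts b \<noteq> {}\<close> by simp
      next
        case False
        then show thesis using that[of b a d] abd True ca by (auto simp: Int_commute insert_commute)
      qed
    next
      case False
      then show thesis using that[of d a b] abd ab bc by (auto simp: Int_commute insert_commute)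
    qed
    have "c p * int (per p) + c q * int (per q) + c r * int (per r) = int n" using total_J pqr by simp
    then have "int (per p) = 2 * int (per q)"
      using three_weights[OF facts(4)[of p] facts(4)[of q] facts(4)[of r] _ bound bound glob(1) facts(1)[of p]
          facts(2)[of p] facts(2)[of q] facts(2)[of r] facts(3)[of q] facts(3)[of r] glob(2)] pqr sh by simp
    then have "per p = 2 * per q" by linarith
    then have "per q dvd per p" by simp
    then show False using no_common_period[of p q] pqr sh J(2) by blast
  qed
  ultimately show False using J(3) by linarith
qed

end

section \<open>Charging squares to circuits\<close>

definition word_seq :: "'a list \<Rightarrow> nat \<Rightarrow> 'a" where
  "word_seq w i = w ! (i mod length w)"

lemma periodic_word_seq: "w \<noteq> [] \<Longrightarrow> periodic (word_seq w) (length w)"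
  by (simp add: periodic_def word_seq_def)

lemma fac_word_seq: "fac (word_seq w) 0 (length w) = w"
  by (auto simp: fac_def word_seq_def intro: nth_equalityI)

lemma square_period:
  assumes "is_square s"
  obtains M where "M > 0" "length s = 2 * M" "periodic (word_seq s) M"
proof -
  obtain u where u: "u \<noteq> []" "s = u @ u" using assms by (auto simp: is_square_def)
  let ?M = "length u"
  have eq: "word_seq s i = u ! (i mod ?M)" for i
  proof -
    let ?r = "i mod (2 * ?M)"
    have r: "?r < 2 * ?M" "?r mod ?M = i mod ?M" using u by (simp_all add: mod_mod_cancel)
    show ?thesis
    proof (cases "?r < ?M")
      case True
      then show ?thesis using r u by (simp add: word_seq_def nth_append flip: mult_2)
    next
      case False
      then have "?r mod ?M = ?r - ?M" using r by (simp add: le_mod_geq)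
      then show ?thesis using False r u by (simp add: word_seq_def nth_append flip: mult_2)
    qed
  qed
  show thesis by (rule that[of ?M]) (use u eq in \<open>simp_all add: periodic_def\<close>)
qed

lemma square_factor_circular:
  assumes "s \<in> square_factors (circular_word w)"
  shows "is_square s" "length s \<le> length w" "s \<in> facs (word_seq w) (length s)"
proof -
  obtain x y a b where w: "w = x @ y" and s: "y @ x = a @ s @ b" and sq: "is_square s"
    using assms unfolding square_factors_def circular_word_def conjugate_def sublist_def by blast
  show "is_square s" by (rule sq)
  have rot: "rotate (length x) w = a @ s @ b" using s w rotate_append by metis
  have len: "length w = length a + length s + length b" using arg_cong[OF rot, of length] by simp
  then show "length s \<le> length w" by simp
  have "s ! t = word_seq w (length x + length a + t)" if "t < length s" for t
  proof -
    have "s ! t = rotate (length x) w ! (length a + t)" using that by (simp add: rot nth_append)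
    also have "\<dots> = word_seq w (length x + length a + t)"
      using that len by (simp add: nth_rotate word_seq_def add.assoc)
    finally show ?thesis .
  qed
  then have "s = fac (word_seq w) (length x + length a) (length s)"
    by (auto simp: fac_def intro: nth_equalityI)
  then show "s \<in> facs (word_seq w) (length s)" using fac_in_facs by metis
qed

lemma shift_eq_refl: "shift_eq x x"
  by (auto simp: shift_eq_def)

lemma shift_eq_sym: "shift_eq x y \<Longrightarrow> shift_eq y x"
  unfolding shift_eq_def by metis

lemma shift_eq_trans:
  assumes "shift_eq x y" "shift_eq y z" shows "shift_eq x z"
proof -
  obtain a b where 1: "\<And>t. x (a + t) = y (b + t)" using assms(1) by (auto simp: shift_eq_def)
  obtain c d where 2: "\<And>t. y (c + t) = z (d + t)" using assms(2) by (auto simp: shift_eq_def)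
  have "x (a + c + t) = z (d + b + t)" for t
    using 1[of "c + t"] 2[of "b + t"] by (simp add: add.assoc add.left_commute)
  then show ?thesis unfolding shift_eq_def by blast
qed

lemma shift_eq_shift:
  assumes "cyclic y" "shift_eq x y"
  shows "\<exists>c. \<forall>i. y i = x (c + i)"
proof -
  obtain a b where ab: "\<And>t. x (a + t) = y (b + t)" using assms(2) by (auto simp: shift_eq_def)
  let ?M = "b * per y"
  have M: "b \<le> ?M" using per_pos[OF assms(1)] by (simp add: Suc_leI)
  have "y i = x (a + (?M - b) + i)" for i
  proof -
    have "y i = y (i + ?M)" using periodic_mult[OF periodic_per[OF assms(1)]] by metis
    also have "i + ?M = b + (?M - b + i)" using M by linarith
    also have "y \<dots> = x (a + (?M - b + i))" using ab by metis
    finally show ?thesis by (simp add: add.assoc)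
  qed
  then show ?thesis by blast
qed

lemma shift_eq_per:
  assumes "cyclic x" "cyclic y" "shift_eq x y" shows "per x = per y"
proof -
  have "per y \<le> per x" if "cyclic x" "cyclic y" "shift_eq x y" for x y :: "nat \<Rightarrow> 'a"
  proof -
    obtain c where "\<forall>i. y i = x (c + i)" using shift_eq_shift[OF \<open>cyclic y\<close> \<open>shift_eq x y\<close>] by blast
    then have "periodic y (per x)" using periodic_per[OF that(1)] by (simp add: periodic_def flip: add.assoc)
    then show ?thesis by (rule per_le)
  qed
  then show ?thesis using assms shift_eq_sym by (meson antisym)
qed

definition rep :: "(nat \<Rightarrow> 'a) \<Rightarrow> nat \<Rightarrow> 'a" where
  "rep x = (SOME y. cyclic y \<and> shift_eq x y)"

lemma rep: "cyclic x \<Longrightarrow> cyclic (rep x) \<and> shift_eq x (rep x)"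
  unfolding rep_def by (rule someI[of _ x]) (simp add: shift_eq_refl)

lemma rep_eqI:
  assumes "shift_eq x y" shows "rep x = rep y"
proof -
  have "(\<lambda>z. cyclic z \<and> shift_eq x z) = (\<lambda>z. cyclic z \<and> shift_eq y z)"
    using assms shift_eq_sym shift_eq_trans by blast
  then show ?thesis unfolding rep_def by simp
qed

text \<open>Among the positions \<open>i, i - 1, \<dots>\<close>, of which there are \<open>per p - card T + 1\<close>, one belongs to \<open>T\<close> modulo the
period, and the long factor that starts there still contains the factor of length \<open>L\<close> at \<open>i\<close>.\<close>

lemma full_range:
  assumes p: "cyclic p" and m: "m \<ge> 1"
    and T: "T \<subseteq> {..<per p}" "\<And>j. j \<in> T \<Longrightarrow> fac p j (2 * m * per p) \<in> facs W (2 * m * per p)"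
    and L: "m * per p < L" "L \<le> m * per p + card T"
  shows "facs p L \<subseteq> facs W L"
proof
  fix v assume "v \<in> facs p L"
  then obtain i0 where i0: "v = fac p i0 L" by (auto simp: facs_def)
  let ?l = "per p"
  \<comment> \<open>Adding a period keeps the differences \<open>i - d\<close> of natural numbers from being truncated.\<close>
  define i where "i = i0 + ?l"
  have pp: "periodic p ?l" using p periodic_per by blast
  have v: "v = fac p i L" using i0 fac_mod[OF pp, of i0 L] fac_mod[OF pp, of i L] by (simp add: i_def)
  define t where "t = card T"
  have t: "1 \<le> t" "t \<le> ?l" using L card_mono[OF _ T(1)] by (simp_all add: t_def)
  let ?f = "\<lambda>d. (i - d) mod ?l"
  have inj: "inj_on ?f {..?l - t}"
  proof -
    have "?f d \<noteq> ?f d'" if "d < d'" "d' \<le> ?l - t" for d d'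
    proof
      assume "?f d = ?f d'"
      then have "?l dvd (i - d) - (i - d')"
        using that t by (subst (asm) mod_eq_dvd_iff_nat) (auto simp: i_def)
      moreover have "(i - d) - (i - d') = d' - d" using that t by (simp add: i_def)
      ultimately show False using that t by (auto dest: dvd_imp_le)
    qed
    then show ?thesis by (intro inj_onI) (metis atMost_iff linorder_neqE_nat)
  qed
  have cf: "card (?f ` {..?l - t}) = ?l - t + 1" using card_image[OF inj] by simp
  have "?f ` {..?l - t} \<inter> T \<noteq> {}"
  proof
    assume disj: "?f ` {..?l - t} \<inter> T = {}"
    have "?f ` {..?l - t} \<union> T \<subseteq> {..<?l}" using T(1) per_pos[OF p] by auto
    then have "card (?f ` {..?l - t} \<union> T) \<le> ?l" using card_mono[of "{..<?l}"] by fastforce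
    moreover have "card (?f ` {..?l - t} \<union> T) = (?l - t + 1) + t"
      using card_Un_disjoint[OF _ finite_subset[OF T(1)] disj] cf by (simp add: t_def)
    ultimately show False using t by linarith
  qed
  then obtain d where d: "d \<le> ?l - t" "?f d \<in> T" by auto
  then have "fac p (i - d) (2 * m * ?l) \<in> facs W (2 * m * ?l)"
    using T(2)[OF d(2)] by (simp add: fac_mod[OF pp])
  then obtain b where b: "fac p (i - d) (2 * m * ?l) = fac W b (2 * m * ?l)" by (auto simp: facs_def)
  have "d + L \<le> 2 * m * ?l"
  proof -
    have "?l \<le> m * ?l" using m by simp
    then show ?thesis using d(1) L(2) t unfolding t_def by linarith
  qed
  moreover have "d \<le> i" using d by (simp add: i_def)
  ultimately have "fac p i L = fac W (b + d) L"
    unfolding fac_eq_iff using b[unfolded fac_eq_iff, rule_format, of "d + _"]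
    by (simp add: add.assoc[symmetric])
  then show "v \<in> facs W L" using v by simp
qed

lemma telescope_bound:
  fixes f g C :: "nat \<Rightarrow> nat"
  assumes "\<And>L. 2 \<le> L \<Longrightarrow> L \<le> N \<Longrightarrow> f L + C (L - 1) \<le> C L + g L" "N \<ge> 1"
  shows "(\<Sum>L=2..N. f L) \<le> C N + (\<Sum>L=2..N. g L)"
proof -
  have "n \<ge> 1 \<Longrightarrow> n \<le> N \<Longrightarrow> (\<Sum>L=2..n. f L) \<le> C n + (\<Sum>L=2..n. g L)" for n
  proof (induction n)
    case (Suc n)
    show ?case
    proof (cases "n = 0")
      case False
      then show ?thesis using Suc assms(1)[of "Suc n"] by simp
    qed simp
  qed simp
  then show ?thesis using assms(2) by blast
qed

text \<open>The circuits charged at length \<open>L\<close>. Since \<open>m * per p < L \<le> (m + 1) * per p\<close> determines \<open>m\<close>, charges for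
different powers of the same primitive word do not collide.\<close>

definition square_circuits :: "'a list \<Rightarrow> nat \<Rightarrow> (nat \<Rightarrow> 'a) set" where
  "square_circuits w L = {p \<in> (\<lambda>s. rep (word_seq s)) ` square_factors (circular_word w).
     facs p L \<subseteq> facs (word_seq w) L \<and>
     (\<exists>m\<ge>1. m * per p < L \<and> L \<le> (m + 1) * per p \<and> 2 * m * per p \<le> length w)}"

lemma finite_square_circuits: "finite (square_circuits w L)"
  unfolding square_circuits_def
  by (rule finite_subset[OF _ finite_imageI[OF finite_square_factors_circular_word]]) blast

lemma square_class:
  assumes "s \<in> square_factors (circular_word w)"
  defines "p \<equiv> rep (word_seq s)"
  defines "m \<equiv> length s div (2 * per p)"
  shows "cyclic p" "m \<ge> 1" "length s = 2 * m * per p" "s \<in> facs p (length s)"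
proof -
  note s = square_factor_circular[OF assms(1)]
  obtain M where M: "M > 0" "length s = 2 * M" "periodic (word_seq s) M" using square_period[OF s(1)] .
  then have cyc: "cyclic (word_seq s)" by (auto simp: cyclic_def)
  show p: "cyclic p" using rep[OF cyc] by (simp add: p_def)
  have sh: "shift_eq (word_seq s) p" using rep[OF cyc] by (simp add: p_def)
  have "per p = per (word_seq s)" using shift_eq_per[OF cyc p sh] by simp
  then have "per p dvd M" using per_dvd[OF M(3)] by simp
  then obtain q where q: "M = per p * q" by (auto simp: dvd_def)
  have "m = q" using per_pos[OF p] by (simp add: m_def M(2) q)
  then show "m \<ge> 1" "length s = 2 * m * per p" using M q by auto
  obtain c where c: "\<And>i. word_seq s i = p (c + i)" using shift_eq_shift[OF cyc shift_eq_sym[OF sh]] by blast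
  have "s = fac p c (length s)"
    using fac_word_seq[of s] fac_eq_iff[of "word_seq s" 0 "length s" p c] c by simp
  then show "s \<in> facs p (length s)" using fac_in_facs by metis
qed

lemma card_squares_le:
  "card (square_factors (circular_word w)) \<le> (\<Sum>L=2..length w. card (square_circuits w L))"
proof -
  let ?S = "square_factors (circular_word w)" and ?W = "word_seq w"
  define phi where "phi s = (rep (word_seq s), length s div (2 * per (rep (word_seq s))))" for s :: "'a list"
  define G where "G = (\<lambda>(p, m). {L. m * per p < L \<and> L \<le> (m + 1) * per p \<and> facs p L \<subseteq> facs ?W L})"
  have fin: "finite ?S" by (rule finite_square_factors_circular_word)
  have finG: "finite (G z)" for z
    by (cases z) (auto simp: G_def intro!: finite_subset[OF _ finite_atMost[of "(snd z + 1) * per (fst z)"]])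
  have fiber: "card {s \<in> ?S. phi s = z} \<le> card (G z)" if z: "z \<in> phi ` ?S" for z
  proof -
    obtain p m where pm: "z = (p, m)" by (cases z)
    have props: "cyclic p" "m \<ge> 1" "length s = 2 * m * per p" "s \<in> facs p (length s)" "s \<in> facs ?W (length s)"
      if "s \<in> ?S" "phi s = z" for s
      using square_class[OF that(1)] square_factor_circular[OF that(1)] that(2) by (auto simp: phi_def pm)
    obtain s0 where s0: "s0 \<in> ?S" "phi s0 = z" using z by blast
    have p: "cyclic p" and m: "m \<ge> 1" using props[OF s0] by blast+
    define T where "T = {j. j < per p \<and> fac p j (2 * m * per p) \<in> facs ?W (2 * m * per p)}"
    have "{s \<in> ?S. phi s = z} \<subseteq> (\<lambda>j. fac p j (2 * m * per p)) ` T"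
    proof
      fix s assume "s \<in> {s \<in> ?S. phi s = z}"
      then have s: "length s = 2 * m * per p" "s \<in> facs p (length s)" "s \<in> facs ?W (length s)"
        using props by blast+
      then show "s \<in> (\<lambda>j. fac p j (2 * m * per p)) ` T"
        using facs_image[OF periodic_per[OF p], of "2 * m * per p"] by (auto simp: T_def)
    qed
    then have "card {s \<in> ?S. phi s = z} \<le> card T"
      using surj_card_le[of T] by (simp add: T_def)
    also have "card T = card {m * per p + 1..m * per p + card T}" by simp
    also have "\<dots> \<le> card (G z)"
    proof (intro card_mono finG subsetI)
      fix L assume L: "L \<in> {m * per p + 1..m * per p + card T}"
      have Ts: "T \<subseteq> {..<per p}" by (auto simp: T_def)
      then have "card T \<le> per p" using card_mono[OF _ Ts] by simp
      moreover have "facs p L \<subseteq> facs ?W L"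
        using full_range[OF p m Ts, of ?W L] L by (auto simp: T_def)
      ultimately show "L \<in> G z" using L by (simp add: G_def pm)
    qed
    finally show ?thesis .
  qed
  have "card ?S = (\<Sum>z\<in>phi ` ?S. card {s \<in> ?S. phi s = z})"
    using sum.image_gen[OF fin, of "\<lambda>_. 1 :: nat" phi] by simp
  also have "\<dots> \<le> (\<Sum>z\<in>phi ` ?S. card (G z))" by (intro sum_mono fiber)
  also have "\<dots> = card (Sigma (phi ` ?S) G)" using fin finG by simp
  also have "\<dots> \<le> card (Sigma {2..length w} (square_circuits w))"
  proof (rule card_inj_on_le)
    let ?h = "\<lambda>((p, m), L). (L, p) :: nat \<times> (nat \<Rightarrow> 'a)"
    have uniq: "m = m'" if "m * l < L" "L \<le> (m + 1) * l" "m' * l < L" "L \<le> (m' + 1) * l" for m m' l L :: nat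
    proof -
      have "m * l < (m' + 1) * l" "m' * l < (m + 1) * l" using that by linarith+
      then have "m < m' + 1" "m' < m + 1" using mult_less_cancel2 by blast+
      then show ?thesis by simp
    qed
    show "inj_on ?h (Sigma (phi ` ?S) G)"
    proof (rule inj_onI)
      fix y z assume yz: "y \<in> Sigma (phi ` ?S) G" "z \<in> Sigma (phi ` ?S) G" and eq: "?h y = ?h z"
      obtain p m L where y: "y = ((p, m), L)" by (metis surj_pair)
      obtain m' where z: "z = ((p, m'), L)" using eq y by (cases z) auto
      have "L \<in> G (p, m)" "L \<in> G (p, m')"
        using yz unfolding y z by (simp_all only: mem_Sigma_iff)
      then have "m = m'" using uniq[of m "per p" L m'] by (simp add: G_def)
      then show "y = z" using y z by simp
    qed
    show "?h ` Sigma (phi ` ?S) G \<subseteq> Sigma {2..length w} (square_circuits w)"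
    proof
      fix y assume "y \<in> ?h ` Sigma (phi ` ?S) G"
      then obtain p m L where z: "(p, m) \<in> phi ` ?S" and L: "L \<in> G (p, m)" and y: "y = (L, p)"
        by (auto simp del: image_iff)
      then obtain s where s: "s \<in> ?S" "phi s = (p, m)" by auto
      note sc = square_class[OF s(1)]
      have pm: "p = rep (word_seq s)" "m = length s div (2 * per (rep (word_seq s)))"
        using arg_cong[OF s(2), of fst] arg_cong[OF s(2), of snd] by (simp_all only: phi_def fst_conv snd_conv)
      have p: "cyclic p" "m \<ge> 1" "length s = 2 * m * per p" unfolding pm by (fact sc)+
      have n: "2 * m * per p \<le> length w" using square_factor_circular(2)[OF s(1)] p by simp
      have "per p \<le> m * per p" using p by simp
      moreover have "1 \<le> m * per p" using p per_pos[OF p(1)] by simp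
      moreover have G: "m * per p < L" "L \<le> (m + 1) * per p" "facs p L \<subseteq> facs ?W L"
        using L by (simp_all add: G_def)
      moreover have "(m + 1) * per p = m * per p + per p" "2 * m * per p = m * per p + m * per p" by simp_all
      ultimately have "2 \<le> L" "L \<le> length w" using n by linarith+
      moreover have "p \<in> (\<lambda>s. rep (word_seq s)) ` ?S" using s(1) pm(1) by blast
      then have "p \<in> square_circuits w L" using G p(2) n unfolding square_circuits_def by blast
      ultimately show "y \<in> Sigma {2..length w} (square_circuits w)" unfolding y by simp
    qed
    show "finite (Sigma {2..length w} (square_circuits w))" using finite_square_circuits by blast
  qed
  also have "\<dots> = (\<Sum>L=2..length w. card (square_circuits w L))"
    by (rule card_SigmaI) (auto simp: finite_square_circuits)
  finally show ?thesis .
qed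

lemma square_circuits_full:
  assumes w: "w \<noteq> []" and L: "L = Suc k"
  shows "full_circuits (word_seq w) (square_circuits w L) k"
proof
  show "cyclic (word_seq w)" using periodic_word_seq[OF w] by (auto simp: cyclic_def)
  show "finite (square_circuits w L)" by (rule finite_square_circuits)
  have rp: "\<exists>s. cyclic (word_seq s) \<and> p = rep (word_seq s)" if "p \<in> square_circuits w L" for p
  proof -
    obtain s where s: "s \<in> square_factors (circular_word w)" "p = rep (word_seq s)"
      using \<open>p \<in> square_circuits w L\<close> by (auto simp: square_circuits_def)
    obtain M where "periodic (word_seq s) M"
      using square_period[OF square_factor_circular(1)[OF s(1)]] .
    then show ?thesis using s(2) cyclic_def by blast
  qed
  show "cyclic p" if "p \<in> square_circuits w L" for p using rp[OF that] rep by blast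
  show "per p \<le> Suc k" if "p \<in> square_circuits w L" for p
  proof -
    obtain m where "m \<ge> 1" "m * per p < L" using \<open>p \<in> square_circuits w L\<close> by (auto simp: square_circuits_def)
    moreover from this have "per p \<le> m * per p" by simp
    ultimately show ?thesis using L by linarith
  qed
  show "facs p (Suc k) \<subseteq> facs (word_seq w) (Suc k)" if "p \<in> square_circuits w L" for p
    using that L by (auto simp: square_circuits_def)
  show "p = q" if "p \<in> square_circuits w L" "q \<in> square_circuits w L" "shift_eq p q" for p q
    using rp[OF that(1)] rp[OF that(2)] rep rep_eqI shift_eq_sym shift_eq_trans that(3) by metis
qed

lemma card_square_circuits_long:
  assumes w: "w \<noteq> []" and prim: "per (word_seq w) = length w"
    and L: "L \<le> length w" "2 * length w < 3 * L"
  shows "card (square_circuits w L) + card (facs (word_seq w) (L - 1)) \<le> card (facs (word_seq w) L)"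
proof (rule ccontr)
  assume less: "\<not> ?thesis"
  obtain k where k: "L = Suc k" using L by (cases L) auto
  interpret full_circuits "word_seq w" "square_circuits w L" k using square_circuits_full[OF w k] .
  have "tight_circuits (word_seq w) (square_circuits w L) k"
  proof
    show "2 * per (word_seq w) < 3 * Suc k" "Suc k \<le> per (word_seq w)" using L prim k by simp_all
    show "card (square_circuits w L) + card (facs (word_seq w) k) = card (facs (word_seq w) (Suc k)) + 1"
      using less rauzy_card k by simp
    fix p assume "p \<in> square_circuits w L"
    then obtain m where m: "m \<ge> 1" "L \<le> (m + 1) * per p" "2 * m * per p \<le> length w"
      by (auto simp: square_circuits_def)
    have "m < 3"
    proof (rule ccontr)
      assume "\<not> m < 3"
      then have "3 * per p \<le> m * per p" by simp
      moreover have "L \<le> m * per p + per p" "2 * (m * per p) \<le> length w"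
        using m by (simp_all add: algebra_simps)
      ultimately show False using L(2) by linarith
    qed
    then consider "m = 1" | "m = 2" using m by linarith
    then show "Suc k \<le> 2 * per p \<and> 2 * per p \<le> per (word_seq w) \<or>
        Suc k \<le> 3 * per p \<and> 4 * per p \<le> per (word_seq w)"
      by cases (use m prim k in auto)
  qed
  then show False by (rule tight_circuits.contradiction)
qed

section \<open>The bound\<close>

theorem mainTheorem1:
  fixes w :: "'a list" and n :: nat
  assumes "length w = n"
  shows "real (Sq (circular_word w)) \<le> 5 / 3 * real n"
proof (cases "w = []")
  case True
  then have "square_factors (circular_word w) = {}"
    using square_factor_circular(1,2)[of _ w] by (fastforce simp: is_square_def)
  then show ?thesis by (simp add: Sq_def)
next
  case False
  let ?W = "word_seq w"
  let ?C = "\<lambda>L. card (facs ?W L)"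
  have n: "n \<ge> 1" using False assms by (cases w) auto
  have per: "periodic ?W n" using periodic_word_seq[OF False] assms by simp
  have Sq: "Sq (circular_word w) \<le> (\<Sum>L=2..n. card (square_circuits w L))"
    using card_squares_le[of w] assms by (simp add: Sq_def)
  have one: "card (square_circuits w L) + ?C (L - 1) \<le> ?C L + 1" if "2 \<le> L" for L
  proof -
    obtain k where k: "L = Suc k" using \<open>2 \<le> L\<close> by (cases L) auto
    show ?thesis using full_circuits.rauzy_card[OF square_circuits_full[OF False k]] k by simp
  qed
  have "3 * Sq (circular_word w) \<le> 5 * n"
  proof (cases "per ?W = n")
    case True
    have "(\<Sum>L=2..n. card (square_circuits w L)) \<le> ?C n + (\<Sum>L=2..n. of_bool (3 * L \<le> 2 * n))"
    proof (rule telescope_bound)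
      show "card (square_circuits w L) + ?C (L - 1) \<le> ?C L + of_bool (3 * L \<le> 2 * n)" if "2 \<le> L" "L \<le> n" for L
        using one[OF that(1)] card_square_circuits_long[OF False, of L] that True assms by (auto simp: not_le)
    qed (rule n)
    moreover have "(\<Sum>L=2..n. of_bool (3 * L \<le> 2 * n)) \<le> 2 * n div 3"
    proof -
      have "(\<Sum>L=2..n. of_bool (3 * L \<le> 2 * n)) = card ({2..n} \<inter> {L. 3 * L \<le> 2 * n})"
        by simp
      also have "\<dots> \<le> card {1..2 * n div 3}" by (intro card_mono) auto
      finally show ?thesis by simp
    qed
    ultimately show ?thesis using Sq card_facs_le[OF per, of n] by linarith
  next
    case ne: False
    obtain q where q: "n = per ?W * q" using per_dvd[OF per] by (auto simp: dvd_def)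
    then have "q \<ge> 2" using ne n by (cases q; cases "q - 1") auto
    then have "2 * per ?W \<le> n" using q by simp
    moreover have "?C n \<le> per ?W" using card_facs_le periodic_per per cyclic_def by blast
    moreover have "(\<Sum>L=2..n. card (square_circuits w L)) \<le> ?C n + (\<Sum>L=2..n. 1)"
      by (rule telescope_bound) (use one n in auto)
    ultimately show ?thesis using Sq by simp
  qed
  then have "real (3 * Sq (circular_word w)) \<le> real (5 * n)" by (simp only: of_nat_le_iff)
  then show ?thesis by simp
qed

end
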